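(* A permutation $\pi$ is $2$-pass sortable (i.e., $t(\pi)\le 1$) if and only if $\pi$ avoids each of the permutations $$24153,\ 24513,\ 24531,\ 34251,\ 35241,\ 42513,\ 42531,\ 45231,\ 261453,\ 231564,\ 523164.$$
   Context: A permutation $\rho$ avoids $\sigma$ if it does not contain $\sigma$ as a pattern (no subsequence of $\rho$ has the same relative order as $\sigma$). Multi-pass stack sorting: in a pass, the entries of the current input are pushed one at a time, in order, onto a stack; whenever the top of the stack is the smallest value not yet output, it is popped to the output (repeatedly); entries are never popped otherwise. When all input entries have been pushed and no pop is possible, if the stack is nonempty the remaining entries are returned to the input in their original relative order and a new pass begins. A permutation is $k$-pass sortable if it is sorted (output $1,\dots,n$) using at most $k$ passes; its tier $t(\pi)$ is one less than the minimum number of passes needed. *)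

theory Defs
  imports "HOL-Combinatorics.Multiset_Permutations" "HOL-Library.Sublist"
begin

text \<open>
  A permutation of size \<open>n\<close> is given in one-line notation, as a list in
  \<open>permutations_of_set {1..n}\<close>.
\<close>

definition same_relative_order :: "nat list \<Rightarrow> nat list \<Rightarrow> bool" where
  "same_relative_order xs ys \<longleftrightarrow>
     length xs = length ys \<and>
     (\<forall>i<length xs. \<forall>j<length xs. xs ! i < xs ! j \<longleftrightarrow> ys ! i < ys ! j)"

definition contains_pattern :: "nat list \<Rightarrow> nat list \<Rightarrow> bool" where
  "contains_pattern \<rho> \<sigma> \<longleftrightarrow> (\<exists>xs. subseq xs \<rho> \<and> same_relative_order xs \<sigma>)"

definition avoids :: "nat list \<Rightarrow> nat list \<Rightarrow> bool" where
  "avoids \<rho> \<sigma> \<longleftrightarrow> \<not> contains_pattern \<rho> \<sigma>"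

text \<open>
  Stacks are lists with the top element first; the output is a list in the order in
  which the entries are emitted. The entries not yet output are exactly those on the
  stack together with those still in the input, so an entry is the smallest value not
  yet output iff it is minimal among these.
\<close>

fun pop_while_possible :: "nat list \<Rightarrow> nat list \<Rightarrow> nat list \<Rightarrow> nat list \<times> nat list" where
  "pop_while_possible inp [] out = ([], out)"
| "pop_while_possible inp (x # stack) out =
     (if \<forall>y \<in> set inp \<union> set stack. x \<le> y
      then pop_while_possible inp stack (out @ [x])
      else (x # stack, out))"

fun run_pass :: "nat list \<Rightarrow> nat list \<Rightarrow> nat list \<Rightarrow> nat list \<times> nat list" where
  "run_pass [] stack out = (stack, out)"
| "run_pass (x # inp) stack out =
     (let (stack', out') = pop_while_possible inp (x # stack) out
      in run_pass inp stack' out')"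

text \<open>
  A complete pass acts on pairs of an input and an output. Entries on the stack lie,
  from bottom to top, in their original relative order, so returning the leftover
  entries to the input in that order reverses the (top-first) stack.
\<close>

definition one_pass :: "nat list \<times> nat list \<Rightarrow> nat list \<times> nat list" where
  "one_pass = (\<lambda>(inp, out). let (stack, out') = run_pass inp [] out in (rev stack, out'))"

definition sorted_after :: "nat \<Rightarrow> nat list \<Rightarrow> bool" where
  "sorted_after j \<pi> \<longleftrightarrow> (one_pass ^^ j) (\<pi>, []) = ([], [1..<Suc (length \<pi>)])"

definition pass_sortable :: "nat \<Rightarrow> nat list \<Rightarrow> bool" where
  "pass_sortable k \<pi> \<longleftrightarrow> (\<exists>j\<le>k. sorted_after j \<pi>)"

text \<open>
  The truncated subtraction only matters for the empty permutation, which needs no pass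
  and gets tier \<open>0\<close>.
\<close>

definition tier :: "nat list \<Rightarrow> nat" where
  "tier \<pi> = (LEAST k. sorted_after k \<pi>) - 1"

end

theory Submission
  imports Defs
begin

text \<open>
  Within a pass, a value \<open>a\<close> can only get stuck below a larger entry \<open>c\<close> if a smaller entry
  \<open>d\<close> comes after \<open>c\<close>. Hence a pass outputs exactly the values below the
  smallest ``2'' of a 231 pattern, and a permutation is not sorted by two passes
  iff it has 231 patterns \<open>b c d\<close> and \<open>y z x\<close> with \<open>b \<le> x\<close>. The eleven patterns are the
  minimal ways to interleave two such triples.
\<close>

section \<open>Subsequences and index lists\<close>

text \<open>Turns occurrences of patterns into increasing lists of positions, so that two
  occurrences in the same list can be compared by how their positions interleave. From right to
  left, the induction on \<open>ys\<close> splits on whether position 0 is used.\<close>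

lemma subseq_iff_indices:
  "subseq xs ys \<longleftrightarrow>
     (\<exists>js. sorted_wrt (<) js \<and> set js \<subseteq> {..<length ys} \<and> xs = map ((!) ys) js)"
proof
  assume "subseq xs ys"
  then show "\<exists>js. sorted_wrt (<) js \<and> set js \<subseteq> {..<length ys} \<and> xs = map ((!) ys) js"
  proof (induction rule: list_emb.induct)
    case (list_emb_Nil ys)
    show ?case by (intro exI[of _ "[]"]) simp
  next
    case (list_emb_Cons xs ys y)
    then obtain js where "sorted_wrt (<) js" "set js \<subseteq> {..<length ys}" "xs = map ((!) ys) js"
      by blast
    then show ?case
      by (intro exI[of _ "map Suc js"]) (auto simp: sorted_wrt_map)
  next
    case (list_emb_Cons2 x y xs ys)
    then obtain js where "sorted_wrt (<) js" "set js \<subseteq> {..<length ys}" "xs = map ((!) ys) js"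
      by blast
    with list_emb_Cons2 show ?case
      by (intro exI[of _ "0 # map Suc js"]) (auto simp: sorted_wrt_map)
  qed
next
  assume "\<exists>js. sorted_wrt (<) js \<and> set js \<subseteq> {..<length ys} \<and> xs = map ((!) ys) js"
  then obtain js where "sorted_wrt (<) js" "set js \<subseteq> {..<length ys}" "xs = map ((!) ys) js"
    by blast
  then show "subseq xs ys"
  proof (induction ys arbitrary: xs js)
    case Nil
    then show ?case by simp
  next
    case (Cons y ys)
    \<comment> \<open>An index list that avoids position 0 can be shifted down by one and then picks
      the same entries from the tail.\<close>
    have *: "subseq (map ((!) (y # ys)) ks) ys"
      if "sorted_wrt (<) ks" "set ks \<subseteq> {0<..<length (y # ys)}" for ks
    proof (rule Cons.IH)
      show "sorted_wrt (<) (map (\<lambda>k. k - 1) ks)"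
        unfolding sorted_wrt_map
        by (rule sorted_wrt_mono_rel[OF _ that(1)]) (use that(2) in fastforce)
      show "set (map (\<lambda>k. k - 1) ks) \<subseteq> {..<length ys}"
        using that(2) by fastforce
      show "map ((!) (y # ys)) ks = map ((!) ys) (map (\<lambda>k. k - 1) ks)"
        using that(2) by (auto simp: nth_Cons')
    qed
    show ?case
    proof (cases "\<exists>ks. js = 0 # ks")
      case True
      then obtain ks where ks: "js = 0 # ks" by blast
      with Cons.prems have "sorted_wrt (<) ks" "set ks \<subseteq> {0<..<length (y # ys)}" by auto
      then have "subseq (map ((!) (y # ys)) ks) ys" by (rule *)
      with ks Cons.prems(3) show ?thesis by simp
    next
      case False
      with Cons.prems have "0 \<notin> set js"
        by (cases js) auto
      with Cons.prems have "set js \<subseteq> {0<..<length (y # ys)}"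
        by (auto simp: less_Suc_eq_0_disj)
      with Cons.prems * [of js] show ?thesis by auto
    qed
  qed
qed

lemma subseq_three_iff_nth:
  "subseq [a, c, d] l \<longleftrightarrow>
     (\<exists>i j k. i < j \<and> j < k \<and> k < length l \<and> l ! i = a \<and> l ! j = c \<and> l ! k = d)"
    (is "_ \<longleftrightarrow> ?R")
proof
  assume "subseq [a, c, d] l"
  then obtain js where js: "sorted_wrt (<) js" "set js \<subseteq> {..<length l}" "[a, c, d] = map ((!) l) js"
    unfolding subseq_iff_indices by (elim exE conjE) (rule that)
  then obtain i j k where "js = [i, j, k]"
    by (auto simp: Cons_eq_map_conv)
  with js have "i < j \<and> j < k \<and> k < length l \<and> l ! i = a \<and> l ! j = c \<and> l ! k = d" by simp
  then show ?R by blast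
next
  assume ?R
  then obtain i j k where "i < j" "j < k" "k < length l" "l ! i = a" "l ! j = c" "l ! k = d"
    by blast
  then show "subseq [a, c, d] l"
    unfolding subseq_iff_indices by (intro exI[of _ "[i, j, k]"]) auto
qed

lemma subseq_filter_iff:
  "subseq xs (filter P ys) \<longleftrightarrow> subseq xs ys \<and> (\<forall>x \<in> set xs. P x)"
proof
  assume *: "subseq xs (filter P ys)"
  have "P x" if "x \<in> set xs" for x
    using list_emb_set[OF * that] by auto
  then show "subseq xs ys \<and> (\<forall>x \<in> set xs. P x)"
    using subseq_order.trans[OF * subseq_filter_left] by blast
next
  assume "subseq xs ys \<and> (\<forall>x \<in> set xs. P x)"
  then have "subseq xs ys" "filter P xs = xs" by (simp_all add: filter_id_conv)
  then show "subseq xs (filter P ys)"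
    using subseq_filter[of xs ys P] by simp
qed

text \<open>A nonempty part embedded in \<open>zs\<close> would end in \<open>x\<close>, so the
  whole subsequence already fits into \<open>ys\<close>.\<close>

lemma subseq_append_last_notin:
  assumes "subseq (xs @ [x]) (ys @ zs)" "x \<notin> set zs"
  shows "subseq (xs @ [x]) ys"
proof -
  obtain us vs where uv: "xs @ [x] = us @ vs" "subseq us ys" "subseq vs zs"
    using assms(1) by (auto elim: subseq_appendE)
  have "vs = []"
  proof (rule ccontr)
    assume "vs \<noteq> []"
    then have "x \<in> set vs" using uv(1) by (metis last_appendR last_in_set last_snoc)
    from list_emb_set[OF uv(3) this] assms(2) show False by auto
  qed
  then show ?thesis using uv by simp
qed

section \<open>The effect of one pass\<close>

text \<open>The name refers to the middle value: these are the entries that play the 2 of some 231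
  pattern, with \<open>c\<close> as the 3 and \<open>d\<close> as the 1.\<close>

definition mids_231 :: "nat list \<Rightarrow> nat set" where
  "mids_231 l = {a. \<exists>c d. subseq [a, c, d] l \<and> d < a \<and> a < c}"

lemma mids_231_subset: "mids_231 l \<subseteq> set l"
proof
  fix a
  assume "a \<in> mids_231 l"
  then obtain c d where "subseq [a, c, d] l" by (auto simp: mids_231_def)
  from list_emb_set[OF this, of a] show "a \<in> set l" by auto
qed

lemma mids_231_append: "mids_231 p \<subseteq> mids_231 (p @ q)"
  unfolding mids_231_def by (blast intro: subseq_rev_drop_many)

section \<open>Output followed by the sorted rest is invariant\<close>

text \<open>A popped entry is minimal among the remaining ones, hence the head of their sorted list,
  so popping only moves the boundary between output and rest. In the end this makes the output
  correct as soon as nothing is left over.\<close>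

lemma pop_while_possible_sort:
  "pop_while_possible inp st out = (st', out') \<Longrightarrow>
     out' @ sort (st' @ inp) = out @ sort (st @ inp)"
  by (induction inp st out rule: pop_while_possible.induct)
     (auto split: if_splits simp: insort_is_Cons ball_Un)

lemma run_pass_sort:
  "run_pass inp st out = (st', out') \<Longrightarrow> out' @ sort st' = out @ sort (st @ inp)"
proof (induction inp st out rule: run_pass.induct)
  case (1 st out)
  then show ?case by simp
next
  case (2 x inp st out)
  obtain s1 o1 where p: "pop_while_possible inp (x # st) out = (s1, o1)" by fastforce
  have "out' @ sort st' = o1 @ sort (s1 @ inp)"
    using 2 p by auto
  also have "\<dots> = out @ sort ((x # st) @ inp)"
    using pop_while_possible_sort[OF p] .
  also have "sort ((x # st) @ inp) = sort (st @ x # inp)"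
    by (rule properties_for_sort) auto
  finally show ?case .
qed

lemma one_pass_sort: "one_pass (l, out) = (l', out') \<Longrightarrow> out' @ sort l' = out @ sort l"
proof -
  assume *: "one_pass (l, out) = (l', out')"
  have "sort (rev st) = sort st" for st :: "nat list"
    by (rule properties_for_sort) auto
  then show ?thesis
    using * run_pass_sort[of l "[]" out] by (auto simp: one_pass_def split: prod.splits)
qed

section \<open>The stack as the part of the processed prefix above a threshold\<close>

text \<open>Here \<open>p\<close> has been read, \<open>inp\<close> has not, and the stack holds the
  entries of \<open>p\<close> from \<open>t\<close> upwards, with \<open>x\<close> on top and about
  to be popped. The remaining entries are at least \<open>x\<close>, so only \<open>a = x\<close>
  has to be excluded: a 3 following \<open>x\<close> would still lie on the stack above
  \<open>x\<close>.\<close>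

lemma mids_231_above_popped:
  assumes "distinct (p @ inp)" "filter ((\<le>) t) p = rev s @ [x]"
    and "\<forall>y \<in> set inp. t \<le> y" "\<forall>y \<in> set inp \<union> set s. x \<le> y"
    and "a \<in> mids_231 (p @ inp)" "t \<le> a"
  shows "x < a"
proof (rule ccontr)
  assume "\<not> x < a"
  have sets: "{y \<in> set p. t \<le> y} = insert x (set s)"
    using arg_cong[OF assms(2), of set] by auto
  have "a \<in> set p \<union> set inp" using assms(5) mids_231_subset by fastforce
  with \<open>t \<le> a\<close> sets have "a \<in> insert x (set s) \<union> set inp" by blast
  with assms(4) have "x \<le> a" by auto
  with \<open>\<not> x < a\<close> have "a = x" by simp
  then obtain c d where cd: "subseq [x, c, d] (p @ inp)" "d < x" "x < c"
    using assms(5) by (auto simp: mids_231_def)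
  \<comment> \<open>No unread entry is smaller than \<open>x\<close>, so \<open>d\<close> has been
    read and the whole occurrence lies in \<open>p\<close>.\<close>
  have "d \<notin> set inp" using assms(4) cd(2) by (meson UnI1 leD)
  then have "subseq [x, c, d] p"
    using cd(1) subseq_append_last_notin[of "[x, c]" d p inp] by simp
  then have "subseq [x, c] p"
    by (rule subseq_order.trans[rotated]) simp
  \<comment> \<open>As \<open>c\<close> exceeds \<open>x\<close> and thus \<open>t\<close>, it is on
    the stack after \<open>x\<close>. But \<open>x\<close> is the last entry there, so
    \<open>x\<close> would have to occur a second time in \<open>s\<close>.\<close>
  then have "subseq [x, c] (rev s @ [x])"
    using \<open>t \<le> a\<close> \<open>a = x\<close> cd(3) unfolding assms(2)[symmetric] subseq_filter_iff by auto
  then have "subseq [x, c] (rev s)"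
    using subseq_append_last_notin[of "[x]" c "rev s" "[x]"] cd(3) by simp
  then have "x \<in> set s"
    using list_emb_set[of "(=)" "[x, c]" "rev s" x] by auto
  moreover have "distinct (rev s @ [x])"
    using assms(1) by (metis assms(2) distinct_append distinct_filter)
  ultimately show False by simp
qed

text \<open>An entry is popped only if it is smaller than all others that remain, so the stack is
  again cut out of \<open>p\<close> by a threshold, and popping \<open>x\<close> raises it to
  \<open>Suc x\<close>. The last two clauses record that popping has stopped because the new top is
  not minimal, and that a raised threshold means that the former top was output.\<close>

lemma pop_while_possible_threshold:
  assumes "distinct (p @ inp)" "st = rev (filter ((\<le>) t) p)"
    and "\<forall>y \<in> set inp. t \<le> y" "\<forall>a \<in> mids_231 (p @ inp). t \<le> a"
  shows "\<exists>t'\<ge>t. fst (pop_while_possible inp st out) = rev (filter ((\<le>) t') p) \<and>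
     (\<forall>y \<in> set inp. t' \<le> y) \<and> (\<forall>a \<in> mids_231 (p @ inp). t' \<le> a) \<and>
     (\<forall>c s. rev (filter ((\<le>) t') p) = c # s \<longrightarrow> (\<exists>y \<in> set inp \<union> set s. y < c)) \<and>
     (t' = t \<or> (st \<noteq> [] \<and> hd st < t'))"
  using assms(2-)
proof (induction st arbitrary: t out)
  case Nil
  then show ?case by (intro exI[of _ t]) auto
next
  case (Cons x s)
  show ?case
  proof (cases "\<forall>y \<in> set inp \<union> set s. x \<le> y")
    case True
    have f: "filter ((\<le>) t) p = rev s @ [x]"
      using arg_cong[OF Cons.prems(1), of rev] by simp
    then have "x \<in> set (filter ((\<le>) t) p)" by simp
    then have x: "x \<in> set p" "t \<le> x" by auto
    have "distinct (rev s @ [x])"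
      using assms(1) by (metis f distinct_append distinct_filter)
    then have xs: "x \<notin> set s" by simp
    \<comment> \<open>By distinctness the other stack entries are strictly larger than
      \<open>x\<close>, so the threshold \<open>Suc x\<close> removes exactly
      \<open>x\<close>.\<close>
    have above: "\<forall>y \<in> set s. Suc x \<le> y"
      using True xs by (metis Suc_leI UnI2 le_neq_implies_less)
    have "filter ((\<le>) (Suc x)) p = filter ((\<le>) (Suc x)) (filter ((\<le>) t) p)"
      using x(2) by (auto intro: filter_cong)
    also have "\<dots> = rev s"
      unfolding f using above by (simp add: filter_id_conv)
    finally have s: "s = rev (filter ((\<le>) (Suc x)) p)" by simp
    have inp: "\<forall>y \<in> set inp. Suc x \<le> y"
      using True x(1) assms(1)
      by (metis Suc_leI UnI1 disjoint_iff distinct_append le_neq_implies_less)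
    have mids: "\<forall>a \<in> mids_231 (p @ inp). Suc x \<le> a"
      using mids_231_above_popped[OF assms(1) f Cons.prems(2) True] Cons.prems(3)
      by (auto simp: Suc_le_eq)
    have pop: "pop_while_possible inp (x # s) out = pop_while_possible inp s (out @ [x])"
      using True by simp
    from Cons.IH[OF s inp mids, of "out @ [x]"] obtain t' where t': "t' \<ge> Suc x"
      "fst (pop_while_possible inp s (out @ [x])) = rev (filter ((\<le>) t') p)"
      "\<forall>y \<in> set inp. t' \<le> y" "\<forall>a \<in> mids_231 (p @ inp). t' \<le> a"
      "\<forall>c s. rev (filter ((\<le>) t') p) = c # s \<longrightarrow> (\<exists>y \<in> set inp \<union> set s. y < c)"
      by blast
    moreover have "t \<le> t'" "hd (x # s) < t'" using x(2) t'(1) by simp_all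
    ultimately show ?thesis unfolding pop by blast
  next
    case False
    then have "pop_while_possible inp (x # s) out = (x # s, out)"
      by (simp only: pop_while_possible.simps if_False)
    moreover have "\<exists>y \<in> set inp \<union> set s. y < x" using False by (meson not_le)
    ultimately show ?thesis
      using Cons.prems(2,3)
      by (intro exI[of _ t], unfold Cons.prems(1)[symmetric]) (simp del: pop_while_possible.simps)
  qed
qed

text \<open>The induction carries two facts that pin the threshold from both sides: \<open>t\<close>
  is a lower bound of the unread entries and of \<open>mids_231\<close>, and the smallest remaining
  entry, if it has been read, is the 2 of a 231 pattern inside the read prefix.\<close>

lemma run_pass_threshold:
  assumes "distinct (p @ inp)"
    and "\<forall>y \<in> set inp. t \<le> y" "\<forall>a \<in> mids_231 (p @ inp). t \<le> a"
    and "\<And>m. m \<in> set p \<Longrightarrow> t \<le> m \<Longrightarrow> (\<forall>y \<in> set (p @ inp). t \<le> y \<longrightarrow> m \<le> y) \<Longrightarrow> m \<in> mids_231 p"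
  shows "\<exists>t'. fst (run_pass inp (rev (filter ((\<le>) t) p)) out) = rev (filter ((\<le>) t') (p @ inp)) \<and>
     (\<forall>a \<in> mids_231 (p @ inp). t' \<le> a) \<and>
     (\<forall>m \<in> set (p @ inp). t' \<le> m \<longrightarrow> (\<forall>y \<in> set (p @ inp). t' \<le> y \<longrightarrow> m \<le> y) \<longrightarrow>
        m \<in> mids_231 (p @ inp))"
  using assms
proof (induction inp arbitrary: p t out)
  case Nil
  note mids = Nil.prems(3,4)[unfolded append_Nil2]
  show ?case
    unfolding append_Nil2 run_pass.simps fst_conv
    by (intro exI[of _ t] conjI refl mids(1) ballI impI) (rule mids(2))
next
  case (Cons x inp)
  let ?p = "p @ [x]"
  let ?st = "x # rev (filter ((\<le>) t) p)"
  have d: "distinct (?p @ inp)" using Cons.prems(1) by simp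
  have st: "?st = rev (filter ((\<le>) t) ?p)" using Cons.prems(2) by simp
  have inp: "\<forall>y \<in> set inp. t \<le> y" using Cons.prems(2) by simp
  have mids: "\<forall>a \<in> mids_231 (?p @ inp). t \<le> a" using Cons.prems(3) by simp
  obtain t' where t': "t \<le> t'"
      "fst (pop_while_possible inp ?st out) = rev (filter ((\<le>) t') ?p)"
      "\<forall>y \<in> set inp. t' \<le> y" "\<forall>a \<in> mids_231 (?p @ inp). t' \<le> a"
      "\<forall>c s. rev (filter ((\<le>) t') ?p) = c # s \<longrightarrow> (\<exists>y \<in> set inp \<union> set s. y < c)"
      "t' = t \<or> (?st \<noteq> [] \<and> hd ?st < t')"
    using pop_while_possible_threshold[OF d st inp mids, of out] by blast
  have "m \<in> mids_231 ?p"
    if m: "m \<in> set ?p" "t' \<le> m" "\<forall>y \<in> set (?p @ inp). t' \<le> y \<longrightarrow> m \<le> y" for m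
  proof (cases "x < t'")
    \<comment> \<open>The new entry \<open>x\<close> has been output. The minimal remaining entry
      \<open>m\<close> is not the top \<open>c\<close> of the stack, since something smaller than
      \<open>c\<close> remains; so \<open>m\<close>, \<open>c\<close>, \<open>x\<close> form a 231
      pattern.\<close>
    case True
    then have "m \<in> set p" using m by auto
    obtain c s where cs: "rev (filter ((\<le>) t') ?p) = c # s"
      using m(1,2) by (cases "rev (filter ((\<le>) t') ?p)") (auto simp: filter_empty_conv)
    then have f: "filter ((\<le>) t') p = rev s @ [c]"
      using True arg_cong[OF cs, of rev] by simp
    have sets: "{y \<in> set p. t' \<le> y} = insert c (set s)"
      using arg_cong[OF f, of set] by auto
    obtain y where y: "y \<in> set inp \<union> set s" "y < c" using t'(5) cs by blast
    have "m \<le> y" using y(1) sets t'(3) m(3) by auto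
    with y(2) have "m < c" by simp
    with sets m(2) \<open>m \<in> set p\<close> have "m \<in> set (rev s)" by auto
    then have "subseq ([m] @ [c]) (rev s @ [c])"
      by (intro list_emb_append_mono) (auto simp: subseq_singleton_left)
    then have "subseq [m, c] (filter ((\<le>) t') p)"
      unfolding f by simp
    then have "subseq [m, c] p" unfolding subseq_filter_iff by blast
    then have "subseq ([m, c] @ [x]) ?p"
      by (intro list_emb_append_mono) auto
    then have "subseq [m, c, x] ?p" "x < m" using True m(2) by simp_all
    with \<open>m < c\<close> show ?thesis
      unfolding mids_231_def by blast
  next
    \<comment> \<open>Nothing was popped, so \<open>x\<close> is the top and is not minimal. Hence
      \<open>m\<close> was read earlier, and the invariant for \<open>p\<close> applies.\<close>
    case False
    then have "t' = t" using t'(6) by simp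
    have "rev (filter ((\<le>) t') ?p) = x # rev (filter ((\<le>) t') p)" using False by simp
    then obtain y where y: "y \<in> set inp \<union> set (rev (filter ((\<le>) t') p))" "y < x"
      using t'(5) by blast
    then have "y \<in> set (?p @ inp)" "t' \<le> y" using t'(3) by auto
    then have "m \<noteq> x" using m(3) y(2) by (meson not_le)
    then have "m \<in> mids_231 p"
      using Cons.prems(4)[of m] m \<open>t' = t\<close> by auto
    then show ?thesis using mids_231_append by blast
  qed
  note IH = Cons.IH[OF d t'(3,4) this, of "snd (pop_while_possible inp ?st out)"]
  have "run_pass (x # inp) (rev (filter ((\<le>) t) p)) out =
      run_pass inp (rev (filter ((\<le>) t') ?p)) (snd (pop_while_possible inp ?st out))"
    unfolding run_pass.simps t'(2)[symmetric] by (simp only: Let_def split_beta)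
  moreover have "p @ x # inp = ?p @ inp" by simp
  ultimately show ?case using IH by (simp only:)
qed

text \<open>The final threshold is a lower bound of \<open>mids_231 l\<close>, and the smallest
  leftover entry belongs to that set, so the leftover starts at the smallest 2.\<close>

lemma fst_one_pass:
  assumes "distinct l"
  shows "fst (one_pass (l, out)) = filter (\<lambda>x. \<exists>a \<in> mids_231 l. a \<le> x) l"
proof -
  \<comment> \<open>With nothing read and threshold 0 the invariants hold trivially.\<close>
  obtain t where t: "fst (run_pass l [] out) = rev (filter ((\<le>) t) l)"
      "\<forall>a \<in> mids_231 l. t \<le> a"
      "\<And>m. m \<in> set l \<Longrightarrow> t \<le> m \<Longrightarrow> \<forall>y \<in> set l. t \<le> y \<longrightarrow> m \<le> y \<Longrightarrow> m \<in> mids_231 l"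
    using run_pass_threshold[of "[]" l 0 out] assms by auto
  have "t \<le> x \<longleftrightarrow> (\<exists>a \<in> mids_231 l. a \<le> x)" if "x \<in> set l" for x
  proof
    assume "t \<le> x"
    let ?R = "{y \<in> set l. t \<le> y}"
    have x: "x \<in> ?R" using that \<open>t \<le> x\<close> by simp
    have "finite ?R" by simp
    moreover have "Min ?R \<in> ?R" using x by (intro Min_in) auto
    ultimately have "Min ?R \<in> mids_231 l" by (intro t(3)) auto
    moreover have "Min ?R \<le> x" using x by (intro Min_le) auto
    ultimately show "\<exists>a \<in> mids_231 l. a \<le> x" by blast
  qed (use t(2) in force)
  then have "filter ((\<le>) t) l = filter (\<lambda>x. \<exists>a \<in> mids_231 l. a \<le> x) l"
    by (intro filter_cong) auto
  then show ?thesis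
    using t(1) by (simp add: one_pass_def split_beta)
qed

section \<open>Iterated passes\<close>

lemma distinct_iterate: "distinct l \<Longrightarrow> distinct (fst ((one_pass ^^ j) (l, out)))"
proof (induction j)
  case (Suc j)
  then show ?case
    using fst_one_pass[of "fst ((one_pass ^^ j) (l, out))" "snd ((one_pass ^^ j) (l, out))"]
    by simp
qed simp

lemma iterate_sort:
  "snd ((one_pass ^^ j) (l, out)) @ sort (fst ((one_pass ^^ j) (l, out))) = out @ sort l"
proof (induction j)
  case (Suc j)
  obtain l1 o1 l2 o2 where "(one_pass ^^ j) (l, out) = (l1, o1)" "one_pass (l1, o1) = (l2, o2)"
    by (metis surj_pair)
  with Suc one_pass_sort[of l1 o1 l2 o2] show ?case by simp
qed simp

text \<open>Only the emptiness of the input has to be tracked: \<open>iterate_sort\<close> then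
  forces the output to be \<open>sort \<pi>\<close>, which is the list from 1 to
  \<open>n\<close>.\<close>

lemma sorted_after_iff:
  assumes "\<pi> \<in> permutations_of_set {1..n}"
  shows "sorted_after j \<pi> \<longleftrightarrow> fst ((one_pass ^^ j) (\<pi>, [])) = []"
proof -
  have "set \<pi> = {1..n}" "distinct \<pi>"
    using assms by (auto simp: permutations_of_set_def)
  moreover from this have "length \<pi> = n"
    by (metis card_atLeastAtMost diff_Suc_1 distinct_card)
  ultimately have "sort \<pi> = [1..<Suc (length \<pi>)]"
    by (metis atLeastLessThanSuc_atLeastAtMost sorted_list_of_set_range
        sorted_list_of_set_sort_remdups distinct_remdups_id)
  then show ?thesis
    using iterate_sort[of j \<pi> "[]"] unfolding sorted_after_def
    by (cases "(one_pass ^^ j) (\<pi>, [])") auto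
qed

lemma iterate_Nil: "fst ((one_pass ^^ j) ([], out)) = []"
proof (induction j)
  case (Suc j)
  then show ?case
    by (cases "(one_pass ^^ j) ([], out)") (simp add: one_pass_def)
qed simp

lemma iterate_mono:
  assumes "fst ((one_pass ^^ i) s) = []" "i \<le> j"
  shows "fst ((one_pass ^^ j) s) = []"
proof -
  have "(one_pass ^^ j) s = (one_pass ^^ (j - i)) ((one_pass ^^ i) s)"
    using assms(2) by (metis comp_apply funpow_add le_add_diff_inverse2)
  then show ?thesis
    using assms(1) iterate_Nil by (metis prod.collapse)
qed

text \<open>The minimum is always output, since each 2 of a 231 pattern has a smaller entry and
  therefore lies above the minimum.\<close>

lemma one_pass_shorter:
  assumes "distinct l" "l \<noteq> []"
  shows "length (fst (one_pass (l, out))) < length l"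
proof -
  have "Min (set l) \<in> set l" using assms(2) by simp
  moreover have "\<not> (\<exists>a \<in> mids_231 l. a \<le> Min (set l))"
  proof
    assume "\<exists>a \<in> mids_231 l. a \<le> Min (set l)"
    then obtain a c d where a: "subseq [a, c, d] l" "d < a" "a \<le> Min (set l)"
      by (auto simp: mids_231_def)
    then have "d \<in> set l" using list_emb_set[OF a(1), of d] by auto
    then have "Min (set l) \<le> d" by simp
    with a show False by simp
  qed
  ultimately show ?thesis
    unfolding fst_one_pass[OF assms(1)] by (intro length_filter_less)
qed

text \<open>Every pass outputs at least one entry. This yields the existence of a sorting number of
  passes, on which the \<open>LEAST\<close> in \<open>tier\<close> relies.\<close>

lemma iterate_length:
  assumes "distinct l"
  shows "fst ((one_pass ^^ length l) (l, out)) = []"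
proof -
  have "length (fst ((one_pass ^^ j) (l, out))) \<le> length l - j" for j
  proof (induction j)
    case (Suc j)
    let ?s = "(one_pass ^^ j) (l, out)"
    show ?case
    proof (cases "fst ?s = []")
      case True
      then show ?thesis using iterate_mono[OF True, of "Suc j"] by simp
    next
      case False
      then have "length (fst (one_pass ?s)) < length (fst ?s)"
        using one_pass_shorter[OF distinct_iterate[OF assms] False, of "snd ?s"] by simp
      with Suc show ?thesis by simp
    qed
  qed simp
  from this[of "length l"] show ?thesis by simp
qed

section \<open>Pass-sortability and tier\<close>

text \<open>An empty input stays empty, so "at most \<open>k\<close> passes" can be tested after
  exactly \<open>k\<close>.\<close>

lemma pass_sortable_iff:
  assumes "\<pi> \<in> permutations_of_set {1..n}"
  shows "pass_sortable k \<pi> \<longleftrightarrow> fst ((one_pass ^^ k) (\<pi>, [])) = []"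
  using iterate_mono unfolding pass_sortable_def sorted_after_iff[OF assms] by blast

text \<open>The \<open>Suc\<close> matches the subtraction in \<open>tier\<close>; also when the
  least number of passes is 0, being at most \<open>Suc k\<close> agrees with its truncated
  predecessor being at most \<open>k\<close>.\<close>

lemma pass_sortable_iff_tier:
  assumes "\<pi> \<in> permutations_of_set {1..n}"
  shows "pass_sortable (Suc k) \<pi> \<longleftrightarrow> tier \<pi> \<le> k"
proof -
  have "distinct \<pi>" using assms by (auto simp: permutations_of_set_def)
  then have "sorted_after (length \<pi>) \<pi>"
    unfolding sorted_after_iff[OF assms] by (rule iterate_length)
  then have "sorted_after (LEAST j. sorted_after j \<pi>) \<pi>" by (rule LeastI)
  moreover have "(LEAST j. sorted_after j \<pi>) \<le> j" if "sorted_after j \<pi>" for j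
    using that by (rule Least_le)
  ultimately have "pass_sortable (Suc k) \<pi> \<longleftrightarrow> (LEAST j. sorted_after j \<pi>) \<le> Suc k"
    unfolding pass_sortable_def by (meson order_trans)
  then show ?thesis unfolding tier_def by linarith
qed

section \<open>Two stacked 231 patterns\<close>

text \<open>Stated by positions because the later case analysis orders the positions of both
  triples. The last inequality is weak: the 2 of the lower pattern may be the 1 of the upper
  one.\<close>

definition stacked_231 :: "nat list \<Rightarrow> bool" where
  "stacked_231 l \<longleftrightarrow>
     (\<exists>i j k i' j' k'. i < j \<and> j < k \<and> k < length l \<and> i' < j' \<and> j' < k' \<and> k' < length l \<and>
        l ! k < l ! i \<and> l ! i < l ! j \<and> l ! k' < l ! i' \<and> l ! i' < l ! j' \<and> l ! i \<le> l ! k')"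

text \<open>The second pass finishes iff the leftover of the first has no 231 pattern, and the
  leftover consists of the entries from the smallest 2 upwards.\<close>

lemma two_passes_iff:
  assumes "distinct l"
  shows "fst ((one_pass ^^ 2) (l, out)) = [] \<longleftrightarrow> \<not> stacked_231 l"
proof -
  have empty: "fst (one_pass (l, out)) = [] \<longleftrightarrow> mids_231 l = {}" if "distinct l" for l out
    unfolding fst_one_pass[OF that] using mids_231_subset[of l] by (auto simp: filter_empty_conv)
  let ?F = "filter (\<lambda>x. \<exists>a \<in> mids_231 l. a \<le> x) l"
  have "fst ((one_pass ^^ 2) (l, out)) = fst (one_pass (?F, snd (one_pass (l, out))))"
    unfolding fst_one_pass[OF assms, of out, symmetric] by (simp add: numeral_2_eq_2)
  then have "fst ((one_pass ^^ 2) (l, out)) = [] \<longleftrightarrow> mids_231 ?F = {}"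
    using empty[of ?F] assms by simp
  also have "mids_231 ?F = {} \<longleftrightarrow>
      \<not> (\<exists>y z x. subseq [y, z, x] l \<and> x < y \<and> y < z \<and> (\<exists>a \<in> mids_231 l. a \<le> x))"
  proof -
    \<comment> \<open>Whether a 231 pattern survives the first pass is decided by its smallest entry
      \<open>x\<close>.\<close>
    have up: "(\<forall>v \<in> set [y, z, x]. \<exists>a \<in> mids_231 l. a \<le> v) \<longleftrightarrow> (\<exists>a \<in> mids_231 l. a \<le> x)"
      if "x < y" "y < z" for x y z
    proof
      assume "\<exists>a \<in> mids_231 l. a \<le> x"
      then obtain a where "a \<in> mids_231 l" "a \<le> x" by blast
      with that show "\<forall>v \<in> set [y, z, x]. \<exists>a \<in> mids_231 l. a \<le> v"
        by (intro ballI bexI[of _ a]) auto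
    qed simp
    have "mids_231 ?F = {} \<longleftrightarrow> \<not> (\<exists>y z x. subseq [y, z, x] ?F \<and> x < y \<and> y < z)"
      unfolding mids_231_def[of ?F] by blast
    also have "\<dots> \<longleftrightarrow> \<not> (\<exists>y z x. subseq [y, z, x] l \<and> x < y \<and> y < z \<and>
        (\<forall>v \<in> set [y, z, x]. \<exists>a \<in> mids_231 l. a \<le> v))"
      unfolding subseq_filter_iff by (simp only: conj_ac)
    also have "\<dots> \<longleftrightarrow> \<not> (\<exists>y z x. subseq [y, z, x] l \<and> x < y \<and> y < z \<and>
        (\<exists>a \<in> mids_231 l. a \<le> x))"
      by (simp only: up cong: conj_cong)
    finally show ?thesis .
  qed
  also have "(\<exists>y z x. subseq [y, z, x] l \<and> x < y \<and> y < z \<and> (\<exists>a \<in> mids_231 l. a \<le> x)) \<longleftrightarrow>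
      stacked_231 l" (is "?L \<longleftrightarrow> _")
  proof
    assume ?L
    then obtain y z x a c d where "subseq [y, z, x] l" "x < y" "y < z" "a \<le> x"
      "subseq [a, c, d] l" "d < a" "a < c"
      unfolding mids_231_def by blast
    then show "stacked_231 l"
      unfolding stacked_231_def subseq_three_iff_nth by blast
  next
    assume "stacked_231 l"
    then obtain i j k i' j' k' where *: "i < j" "j < k" "k < length l" "i' < j'" "j' < k'" "k' < length l"
      "l ! k < l ! i" "l ! i < l ! j" "l ! k' < l ! i'" "l ! i' < l ! j'" "l ! i \<le> l ! k'"
      unfolding stacked_231_def by blast
    then have "l ! i \<in> mids_231 l" "subseq [l ! i', l ! j', l ! k'] l"
      unfolding mids_231_def subseq_three_iff_nth by blast+
    with * show ?L by blast
  qed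
  finally show ?thesis .
qed

text \<open>The condition only compares positions with positions and values with values, so it
  carries over along any occurrence of \<open>\<sigma>\<close>.\<close>

lemma stacked_231_if_contains:
  assumes "contains_pattern l \<sigma>" "stacked_231 \<sigma>"
  shows "stacked_231 l"
proof -
  obtain js where js: "sorted_wrt (<) js" "set js \<subseteq> {..<length l}"
      and iso: "same_relative_order (map ((!) l) js) \<sigma>"
    using assms(1) unfolding contains_pattern_def subseq_iff_indices by blast
  have len: "length js = length \<sigma>" using iso by (simp add: same_relative_order_def)
  have less: "l ! (js ! i) < l ! (js ! j) \<longleftrightarrow> \<sigma> ! i < \<sigma> ! j" if "i < length \<sigma>" "j < length \<sigma>" for i j
    using iso that len by (simp add: same_relative_order_def)
  have mono: "js ! i < js ! j" if "i < j" "j < length \<sigma>" for i j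
    using js(1) that len by (simp add: sorted_wrt_nth_less)
  have bound: "js ! i < length l" if "i < length \<sigma>" for i
    using js(2) that len by (metis lessThan_iff nth_mem subsetD)
  \<comment> \<open>The weak inequality becomes a negated strict one, as
    \<open>same_relative_order\<close> speaks of strict comparisons.\<close>
  obtain i j k i' j' k' where *: "i < j" "j < k" "k < length \<sigma>" "i' < j'" "j' < k'" "k' < length \<sigma>"
      "\<sigma> ! k < \<sigma> ! i" "\<sigma> ! i < \<sigma> ! j" "\<sigma> ! k' < \<sigma> ! i'" "\<sigma> ! i' < \<sigma> ! j'" "\<not> \<sigma> ! k' < \<sigma> ! i"
    using assms(2) unfolding stacked_231_def by (auto simp: not_less)
  have len: "i < length \<sigma>" "j < length \<sigma>" "i' < length \<sigma>" "j' < length \<sigma>"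
    using * by simp_all
  have "l ! (js ! k) < l ! (js ! i)" "l ! (js ! i) < l ! (js ! j)"
    "l ! (js ! k') < l ! (js ! i')" "l ! (js ! i') < l ! (js ! j')" "l ! (js ! i) \<le> l ! (js ! k')"
    using * len by (simp_all add: less flip: not_less)
  moreover have "js ! i < js ! j" "js ! j < js ! k" "js ! k < length l"
    "js ! i' < js ! j'" "js ! j' < js ! k'" "js ! k' < length l"
    using * len by (simp_all add: mono bound)
  ultimately show ?thesis
    unfolding stacked_231_def by blast
qed

text \<open>The list \<open>ks\<close> holds the positions of the pattern in \<open>l\<close>, ordered by increasing value.\<close>

lemma contains_patternI:
  assumes "sorted_wrt (\<lambda>i j. l ! i < l ! j) ks" "set ks \<subseteq> {..<length l}"
    and "set \<sigma> \<subseteq> {1..length ks}" "sorted_wrt (<) (map (\<lambda>s. ks ! (s - 1)) \<sigma>)"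
  shows "contains_pattern l \<sigma>"
proof -
  \<comment> \<open>Pattern entries count from 1 and list positions from 0, hence the shift.\<close>
  let ?js = "map (\<lambda>s. ks ! (s - 1)) \<sigma>"
  have mono: "l ! (ks ! (s - 1)) < l ! (ks ! (t - 1))"
    if "s < t" "s \<in> set \<sigma>" "t \<in> set \<sigma>" for s t
  proof (rule sorted_wrt_nth_less[OF assms(1)])
    have "1 \<le> s" "1 \<le> t" "t \<le> length ks" using assms(3) that by auto
    with that(1) show "s - 1 < t - 1" "t - 1 < length ks" by simp_all
  qed
  have iff: "l ! (ks ! (s - 1)) < l ! (ks ! (t - 1)) \<longleftrightarrow> s < t"
    if "s \<in> set \<sigma>" "t \<in> set \<sigma>" for s t
    using mono[of s t] mono[of t s] that by (cases s t rule: linorder_cases) auto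
  have "ks ! (s - 1) \<in> set ks" if "s \<in> set \<sigma>" for s
  proof (rule nth_mem)
    have "1 \<le> s" "s \<le> length ks" using assms(3) that by auto
    then show "s - 1 < length ks" by simp
  qed
  then have "set ?js \<subseteq> {..<length l}" using assms(2) by auto
  moreover have "same_relative_order (map ((!) l) ?js) \<sigma>"
    unfolding same_relative_order_def using iff by simp
  ultimately show ?thesis
    using assms(4) unfolding contains_pattern_def subseq_iff_indices by blast
qed

section \<open>The eleven patterns\<close>

definition tier_patterns :: "nat list set" where
  "tier_patterns = {[2,4,1,5,3], [2,4,5,1,3], [2,4,5,3,1], [3,4,2,5,1], [3,5,2,4,1],
                   [4,2,5,1,3], [4,2,5,3,1], [4,5,2,3,1],
                   [2,6,1,4,5,3], [2,3,1,5,6,4], [5,2,3,1,6,4]}"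

lemma tier_patterns_stacked: "\<sigma> \<in> tier_patterns \<Longrightarrow> stacked_231 \<sigma>"
proof -
  have I: "stacked_231 l" if "i < j \<and> j < k \<and> k < length l \<and> i' < j' \<and> j' < k' \<and> k' < length l \<and>
        l ! k < l ! i \<and> l ! i < l ! j \<and> l ! k' < l ! i' \<and> l ! i' < l ! j' \<and> l ! i \<le> l ! k'"
    for l i j k i' j' k'
    using that unfolding stacked_231_def by blast
  \<comment> \<open>The first three numbers are the positions of the lower 231 pattern, the last
    three those of the upper one. They may share entries: in 34251 the entry 2 is the 2 of 251 and
    the 1 of 342.\<close>
  have "stacked_231 [2,4,1,5,3]" by (rule I[of 0 1 2 _ 1 3 4]) simp
  moreover have "stacked_231 [2,4,5,1,3]" by (rule I[of 0 1 3 _ 1 2 4]) simp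
  moreover have "stacked_231 [2,4,5,3,1]" by (rule I[of 0 1 4 _ 1 2 3]) simp
  moreover have "stacked_231 [3,4,2,5,1]" by (rule I[of 2 3 4 _ 0 1 2]) simp
  moreover have "stacked_231 [3,5,2,4,1]" by (rule I[of 2 3 4 _ 0 1 2]) simp
  moreover have "stacked_231 [4,2,5,1,3]" by (rule I[of 1 2 3 _ 0 2 4]) simp
  moreover have "stacked_231 [4,2,5,3,1]" by (rule I[of 1 2 4 _ 0 2 3]) simp
  moreover have "stacked_231 [4,5,2,3,1]" by (rule I[of 2 3 4 _ 0 1 3]) simp
  moreover have "stacked_231 [2,6,1,4,5,3]" by (rule I[of 0 1 2 _ 3 4 5]) simp
  moreover have "stacked_231 [2,3,1,5,6,4]" by (rule I[of 0 1 2 _ 3 4 5]) simp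
  moreover have "stacked_231 [5,2,3,1,6,4]" by (rule I[of 1 2 3 _ 0 4 5]) simp
  ultimately show "\<sigma> \<in> tier_patterns \<Longrightarrow> stacked_231 \<sigma>"
    unfolding tier_patterns_def by (elim insertE emptyE) simp_all
qed

text \<open>The values satisfy \<open>d < b \<le> x < y < z\<close> and \<open>b < c\<close>, so
  only the interleaving of the positions and the rank of \<open>c\<close> are open. In most cases
  one entry can take over a role in the other triple, which leaves five entries; otherwise a pattern
  of length six appears.\<close>

lemma contains_tier_pattern:
  assumes "distinct l" "stacked_231 l"
  shows "\<exists>\<sigma> \<in> tier_patterns. contains_pattern l \<sigma>"
proof -
  have hit: ?thesis if "contains_pattern l \<sigma>" "\<sigma> \<in> tier_patterns" for \<sigma>
    using that by (rule rev_bexI[rotated])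
  obtain b c d y z x where pos: "b < c" "c < d" "d < length l" "y < z" "z < x" "x < length l"
    and val: "l ! d < l ! b" "l ! b < l ! c" "l ! x < l ! y" "l ! y < l ! z" "l ! b \<le> l ! x"
    using assms(2) unfolding stacked_231_def by blast
  have eq: "l ! i = l ! j \<longleftrightarrow> i = j" if "i < length l" "j < length l" for i j
    using assms(1) that by (simp add: nth_eq_iff_index_eq)
  have len: "b < length l" "c < length l" "y < length l" "z < length l" using pos by simp_all
  have neq: "b \<noteq> y" "b \<noteq> z" "d \<noteq> x" "d \<noteq> y" "d \<noteq> z" using val by auto
  \<comment> \<open>Here \<open>b\<close> can serve as the 1 for \<open>y\<close> and
    \<open>z\<close>. The positions are ordered \<open>y\<close>, \<open>z\<close>,
    \<open>b\<close>, \<open>c\<close>, \<open>d\<close>, and the rank of \<open>c\<close> decides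
    between three patterns.\<close>
  have after: ?thesis if "z < b"
  proof -
    have "l ! c \<noteq> l ! y" "l ! c \<noteq> l ! z" using eq that pos len by auto
    then consider "l ! c < l ! y" | "l ! y < l ! c" "l ! c < l ! z" | "l ! z < l ! c" by linarith
    then show ?thesis
    proof cases
      case 1
      have "contains_pattern l [4,5,2,3,1]"
        by (rule contains_patternI[of _ "[d, b, c, y, z]"]) (use pos val len that 1 in simp_all)
      then show ?thesis by (rule hit) (simp add: tier_patterns_def)
    next
      case 2
      have "contains_pattern l [3,5,2,4,1]"
        by (rule contains_patternI[of _ "[d, b, y, c, z]"]) (use pos val len that 2 in simp_all)
      then show ?thesis by (rule hit) (simp add: tier_patterns_def)
    next
      case 3
      have "contains_pattern l [3,4,2,5,1]"
        by (rule contains_patternI[of _ "[d, b, y, z, c]"]) (use pos val len that 3 in simp_all)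
      then show ?thesis by (rule hit) (simp add: tier_patterns_def)
    qed
  qed
  show ?thesis
  proof (cases "z < b")
    case True
    then show ?thesis by (rule after)
  next
    case False
    then have bz: "b < z" using neq by simp
    \<comment> \<open>From \<open>b < z < x\<close> the positions \<open>b\<close> and
      \<open>x\<close> differ, so distinctness makes the inequality between their values
      strict.\<close>
    then have "b \<noteq> x" using pos by simp
    then have bx: "l ! b < l ! x" using val(5) eq[of b x] len pos by simp
    note val = val bx
    \<comment> \<open>In \<open>yzd\<close> the entry at \<open>y\<close> lies between
      \<open>b\<close> and \<open>d\<close> and replaces \<open>c\<close> as the 3 of the lower
      pattern; in \<open>early\<close> the entry at \<open>z\<close> does so. In \<open>late\<close>
      and \<open>mid\<close> the entry at \<open>c\<close> is kept and its rank matters.\<close>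
    consider (yzd) "b < y" "y < d" | (late) "b < y" "d < y" | (early) "y < b" "z < d"
      | (mid) "y < b" "d < z"
      using neq by linarith
    then show ?thesis
    proof cases
      case yzd
      consider "d < z" | "z < d" "d < x" | "x < d" using neq by linarith
      then show ?thesis
      proof cases
        case 1
        have "contains_pattern l [2,4,1,5,3]"
          by (rule contains_patternI[of _ "[d, b, x, y, z]"]) (use pos val len yzd 1 in simp_all)
        then show ?thesis by (rule hit) (simp add: tier_patterns_def)
      next
        case 2
        have "contains_pattern l [2,4,5,1,3]"
          by (rule contains_patternI[of _ "[d, b, x, y, z]"]) (use pos val len yzd 2 in simp_all)
        then show ?thesis by (rule hit) (simp add: tier_patterns_def)
      next
        case 3
        have "contains_pattern l [2,4,5,3,1]"
          by (rule contains_patternI[of _ "[d, b, x, y, z]"]) (use pos val len yzd 3 in simp_all)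
        then show ?thesis by (rule hit) (simp add: tier_patterns_def)
      qed
    next
      case early
      consider "d < x" | "x < d" using neq by linarith
      then show ?thesis
      proof cases
        case 1
        have "contains_pattern l [4,2,5,1,3]"
          by (rule contains_patternI[of _ "[d, b, x, y, z]"]) (use pos val len early bz 1 in simp_all)
        then show ?thesis by (rule hit) (simp add: tier_patterns_def)
      next
        case 2
        have "contains_pattern l [4,2,5,3,1]"
          by (rule contains_patternI[of _ "[d, b, x, y, z]"]) (use pos val len early bz 2 in simp_all)
        then show ?thesis by (rule hit) (simp add: tier_patterns_def)
      qed
    next
      case late
      \<comment> \<open>The positions are now ordered \<open>b\<close>, \<open>c\<close>,
        \<open>d\<close>, \<open>y\<close>, \<open>z\<close>, \<open>x\<close>.\<close>
      have "l ! c \<noteq> l ! x" "l ! c \<noteq> l ! z" using eq late pos len by auto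
      then consider "l ! c < l ! x" | "l ! x < l ! c" "l ! c < l ! z" | "l ! z < l ! c" by linarith
      then show ?thesis
      proof cases
        case 1
        have "contains_pattern l [2,3,1,5,6,4]"
          by (rule contains_patternI[of _ "[d, b, c, x, y, z]"]) (use pos val len late 1 in simp_all)
        then show ?thesis by (rule hit) (simp add: tier_patterns_def)
      next
        case 2
        \<comment> \<open>With its value between those at \<open>x\<close> and \<open>z\<close>, the
          entry at \<open>c\<close> replaces \<open>y\<close> as the 2 of the upper pattern.\<close>
        have "contains_pattern l [2,4,1,5,3]"
          by (rule contains_patternI[of _ "[d, b, x, c, z]"]) (use pos val len late 2 in simp_all)
        then show ?thesis by (rule hit) (simp add: tier_patterns_def)
      next
        case 3
        have "contains_pattern l [2,6,1,4,5,3]"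
          by (rule contains_patternI[of _ "[d, b, x, y, z, c]"]) (use pos val len late 3 in simp_all)
        then show ?thesis by (rule hit) (simp add: tier_patterns_def)
      qed
    next
      case mid
      \<comment> \<open>The positions are now ordered \<open>y\<close>, \<open>b\<close>,
        \<open>c\<close>, \<open>d\<close>, \<open>z\<close>, \<open>x\<close>.\<close>
      have "l ! c \<noteq> l ! x" "l ! c \<noteq> l ! z" using eq mid pos len by auto
      then consider "l ! c < l ! x" | "l ! x < l ! c" "l ! c < l ! z" | "l ! z < l ! c" by linarith
      then show ?thesis
      proof cases
        case 1
        have "contains_pattern l [5,2,3,1,6,4]"
          by (rule contains_patternI[of _ "[d, b, c, x, y, z]"]) (use pos val len mid 1 in simp_all)
        then show ?thesis by (rule hit) (simp add: tier_patterns_def)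
      next
        case 2
        have "contains_pattern l [2,4,1,5,3]"
          by (rule contains_patternI[of _ "[d, b, x, c, z]"]) (use pos val len mid 2 in simp_all)
        then show ?thesis by (rule hit) (simp add: tier_patterns_def)
      next
        case 3
        \<comment> \<open>Being larger than the entry at \<open>z\<close>, the entry at
          \<open>c\<close> also serves as the 3 of the upper pattern.\<close>
        have "contains_pattern l [4,2,5,1,3]"
          by (rule contains_patternI[of _ "[d, b, x, y, c]"]) (use pos val len mid 3 in simp_all)
        then show ?thesis by (rule hit) (simp add: tier_patterns_def)
      qed
    qed
  qed
qed

theorem theorem2p8:
  fixes n :: nat and \<pi> :: "nat list"
  assumes "\<pi> \<in> permutations_of_set {1..n}"
  shows "(pass_sortable 2 \<pi> \<longleftrightarrow> tier \<pi> \<le> 1) \<and>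
         (pass_sortable 2 \<pi> \<longleftrightarrow>
           (\<forall>\<sigma> \<in> {[2,4,1,5,3], [2,4,5,1,3], [2,4,5,3,1], [3,4,2,5,1], [3,5,2,4,1],
                   [4,2,5,1,3], [4,2,5,3,1], [4,5,2,3,1],
                   [2,6,1,4,5,3], [2,3,1,5,6,4], [5,2,3,1,6,4]}. avoids \<pi> \<sigma>))"
proof
  show "pass_sortable 2 \<pi> \<longleftrightarrow> tier \<pi> \<le> 1"
    using pass_sortable_iff_tier[OF assms, of 1] by (simp add: numeral_2_eq_2)
  have "distinct \<pi>" using assms by (auto simp: permutations_of_set_def)
  then have "pass_sortable 2 \<pi> \<longleftrightarrow> \<not> stacked_231 \<pi>"
    unfolding pass_sortable_iff[OF assms] by (rule two_passes_iff)
  also have "\<dots> \<longleftrightarrow> (\<forall>\<sigma> \<in> tier_patterns. avoids \<pi> \<sigma>)"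
    unfolding avoids_def
    using contains_tier_pattern[OF \<open>distinct \<pi>\<close>] stacked_231_if_contains tier_patterns_stacked
    by blast
  finally have "pass_sortable 2 \<pi> \<longleftrightarrow> (\<forall>\<sigma> \<in> tier_patterns. avoids \<pi> \<sigma>)" .
  from this[unfolded tier_patterns_def] show "pass_sortable 2 \<pi> \<longleftrightarrow>
           (\<forall>\<sigma> \<in> {[2,4,1,5,3], [2,4,5,1,3], [2,4,5,3,1], [3,4,2,5,1], [3,5,2,4,1],
                   [4,2,5,1,3], [4,2,5,3,1], [4,5,2,3,1],
                   [2,6,1,4,5,3], [2,3,1,5,6,4], [5,2,3,1,6,4]}. avoids \<pi> \<sigma>)" .
qed

end
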